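(* Let $f:\mathbb{R}^n\to\mathbb{R}$ be locally Lipschitz, $\mathbf{x}_{k+1}\in\mathbb{R}^n$, and let $\mathbf{v}_{k+1}\in\mathbb{R}^n\setminus\{0\}$ and $\widetilde{\mathbf{d}}_{k+1}\in\mathbb{R}^n\setminus\{0\}$ satisfy, for some $\varrho\in(0,1)$, the bounded angle condition $$\mathbf{v}_{k+1}^\top\widetilde{\mathbf{d}}_{k+1}\le-\varrho\|\mathbf{v}_{k+1}\|\,\|\widetilde{\mathbf{d}}_{k+1}\|<0.$$ Assume that there are $\xi_{k+1}\ge0$ and $\theta\in(0,1)$ such that $$\left|f^\circ(\mathbf{x}_{k+1};\widetilde{\mathbf{d}}_{k+1})-\mathbf{v}_{k+1}^\top\widetilde{\mathbf{d}}_{k+1}\right|\le\xi_{k+1}\|\widetilde{\mathbf{d}}_{k+1}\|\qquad\text{and}\qquad \xi_{k+1}\le\theta\varrho\|\mathbf{v}_{k+1}\|.$$ Then, for every $\mu_1\in(0,1-\theta)$, there exists $t_k>0$ such that $$f(\mathbf{x}_{k+1}+t_k\widetilde{\mathbf{d}}_{k+1})\le f(\mathbf{x}_{k+1})+\mu_1t_k\,\mathbf{v}_{k+1}^\top\widetilde{\mathbf{d}}_{k+1}.$$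
   Context: $\|\cdot\|$ is the Euclidean norm. For a locally Lipschitz function $f$, the Clarke generalized directional derivative is $f^\circ(\mathbf{x};\mathbf{d})=\limsup_{\mathbf{y}\to\mathbf{x},\,t\downarrow0}\frac{f(\mathbf{y}+t\mathbf{d})-f(\mathbf{y})}{t}$. *)

theory Defs
  imports "HOL-Analysis.Analysis"
begin

text \<open>
  The library's \<^const>\<open>local_lipschitz\<close> is stated for families of functions with a
  parameter; this is the version for a single function on the whole space
  (see \<open>locally_lipschitz_iff_local_lipschitz\<close>).
\<close>
definition locally_lipschitz :: "('a::metric_space \<Rightarrow> 'b::metric_space) \<Rightarrow> bool" where
  "locally_lipschitz f \<longleftrightarrow> (\<forall>x. \<exists>u>0. \<exists>L. L-lipschitz_on (ball x u) f)"

text \<open>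
  The upper limit is taken jointly over \<open>y \<rightarrow> x\<close>, where \<open>y = x\<close> is allowed
  (hence \<^term>\<open>nhds x\<close> and not \<^term>\<open>at x\<close>), and \<open>t \<down> 0\<close>.
  It is formed in \<^typ>\<open>ereal\<close>, where it always exists; for locally Lipschitz functions
  it is finite (see \<open>clarke_dd_finite\<close>).
\<close>
definition clarke_dd :: "('a::real_normed_vector \<Rightarrow> real) \<Rightarrow> 'a \<Rightarrow> 'a \<Rightarrow> ereal" where
  "clarke_dd f x d =
     Limsup (nhds x \<times>\<^sub>F at_right 0) (\<lambda>(y, t). ereal ((f (y + t *\<^sub>R d) - f y) / t))"

lemma locally_lipschitz_iff_local_lipschitz:
  "locally_lipschitz f \<longleftrightarrow> local_lipschitz (UNIV :: real set) UNIV (\<lambda>_. f)"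
proof
  assume f: "locally_lipschitz f"
  show "local_lipschitz (UNIV :: real set) UNIV (\<lambda>_. f)"
  proof (rule local_lipschitzI)
    fix t :: real and x
    from f obtain u L where u: "u > 0" "L-lipschitz_on (ball x u) f"
      unfolding locally_lipschitz_def by blast
    have "cball x (u/2) \<subseteq> ball x u" using u by auto
    then have "L-lipschitz_on (cball x (u/2)) f" using u lipschitz_on_subset by blast
    then show "\<exists>u>0. \<exists>L. \<forall>t\<in>cball t u \<inter> UNIV. L-lipschitz_on (cball x u \<inter> UNIV) f"
      using u by (intro exI[of _ "u/2"]) auto
  qed
next
  assume f: "local_lipschitz (UNIV :: real set) UNIV (\<lambda>_. f)"
  show "locally_lipschitz f"
    unfolding locally_lipschitz_def
  proof
    fix x
    from f[unfolded local_lipschitz_def, rule_format, of x 0] obtain u L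
      where u: "u > 0" and L: "\<And>t. t \<in> cball (0::real) u \<inter> UNIV \<Longrightarrow> L-lipschitz_on (cball x u \<inter> UNIV) f"
      by blast
    have "L-lipschitz_on (cball x u) f" using L[of 0] u by simp
    then have "L-lipschitz_on (ball x u) f" by (rule lipschitz_on_subset) (rule ball_subset_cball)
    with u show "\<exists>u>0. \<exists>L. L-lipschitz_on (ball x u) f" by blast
  qed
qed

lemma clarke_dd_finite:
  fixes f :: "'a::real_normed_vector \<Rightarrow> real"
  assumes "locally_lipschitz f"
  shows "\<bar>clarke_dd f x d\<bar> \<noteq> \<infinity>"
proof -
  let ?F = "nhds x \<times>\<^sub>F at_right (0::real)"
  let ?q = "\<lambda>(y, t). ereal ((f (y + t *\<^sub>R d) - f y) / t)"
  from assms obtain u L where u: "u > 0" and L: "L-lipschitz_on (ball x u) f"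
    unfolding locally_lipschitz_def by blast
  have t1: "(fst \<longlongrightarrow> x) ?F" by (rule filterlim_fst)
  have t2: "(snd \<longlongrightarrow> 0) ?F"
    by (rule filterlim_mono[OF filterlim_snd _ order_refl]) (simp add: at_within_def)
  have "((\<lambda>p. fst p + snd p *\<^sub>R d) \<longlongrightarrow> x + 0 *\<^sub>R d) ?F"
    by (intro tendsto_intros t1 t2)
  then have e1: "\<forall>\<^sub>F p in ?F. fst p + snd p *\<^sub>R d \<in> ball x u"
    by (rule topological_tendstoD[OF _ open_ball]) (simp add: u)
  have e2: "\<forall>\<^sub>F p in ?F. fst p \<in> ball x u"
    by (rule topological_tendstoD[OF t1 open_ball]) (simp add: u)
  have e3: "\<forall>\<^sub>F p in ?F. snd p > 0"
    by (rule eventually_compose_filterlim[OF _ filterlim_snd]) (rule eventually_at_right_less)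
  have bd: "\<forall>\<^sub>F p in ?F. ?q p \<le> ereal (L * norm d) \<and> ereal (- (L * norm d)) \<le> ?q p"
    using e1 e2 e3
  proof eventually_elim
    case (elim p)
    have "\<bar>f (fst p + snd p *\<^sub>R d) - f (fst p)\<bar> \<le> L * (snd p * norm d)"
      using lipschitz_onD[OF L elim(1,2)] elim(3) by (simp add: dist_norm)
    then have "\<bar>f (fst p + snd p *\<^sub>R d) - f (fst p)\<bar> / \<bar>snd p\<bar> \<le> L * norm d"
      using elim(3) by (simp add: pos_divide_le_eq ac_simps)
    then have "\<bar>(f (fst p + snd p *\<^sub>R d) - f (fst p)) / snd p\<bar> \<le> L * norm d"
      unfolding abs_divide .
    then show ?case unfolding abs_le_iff case_prod_beta ereal_less_eq by linarith
  qed
  have nb: "?F \<noteq> bot" by (simp add: prod_filter_eq_bot)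
  have "Limsup ?F ?q \<le> ereal (L * norm d)"
    by (rule Limsup_bounded) (rule eventually_mono[OF bd], rule conjunct1)
  moreover have "ereal (- (L * norm d)) \<le> Limsup ?F ?q"
  proof (rule order_trans[OF _ Liminf_le_Limsup[OF nb]], rule Liminf_bounded)
    show "\<forall>\<^sub>F p in ?F. ereal (- (L * norm d)) \<le> ?q p"
      by (rule eventually_mono[OF bd]) (rule conjunct2)
  qed
  ultimately show ?thesis unfolding clarke_dd_def by auto
qed

end

theory Submission
  imports Defs
begin

text \<open>
  The angle condition turns the bound \<open>\<theta> * \<rho> * norm v * norm d\<close> on the approximation error into
  the bound \<open>- \<theta> * (v \<bullet> d)\<close>. Hence the generalized derivative along \<open>d\<close> is at most
  \<open>(1 - \<theta>) * (v \<bullet> d)\<close>, which is strictly below \<open>\<mu> * (v \<bullet> d)\<close> because \<open>v \<bullet> d\<close> is negative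
  and \<open>\<mu> < 1 - \<theta>\<close>. A strict upper bound on the generalized derivative bounds the difference
  quotients at the base point itself for all small step sizes
  (\<open>clarke_dd_less_imp_eventually_decrease\<close>), and this is the sufficient decrease condition.
\<close>

text \<open>
  The upper limit ranges over base points near \<open>x\<close>, with \<open>x\<close> itself included; a bound on the joint
  limit therefore restricts to the ray from \<open>x\<close>.
\<close>
lemma clarke_dd_less_imp_eventually_decrease:
  fixes f :: "'a::real_normed_vector \<Rightarrow> real"
  assumes "clarke_dd f x d < ereal c"
  shows "\<forall>\<^sub>F t in at_right 0. f (x + t *\<^sub>R d) < f x + t * c"
proof -
  have "\<forall>\<^sub>F p in nhds x \<times>\<^sub>F at_right 0. (f (fst p + snd p *\<^sub>R d) - f (fst p)) / snd p < c"
    using Limsup_lessD[OF assms[unfolded clarke_dd_def]] by (simp add: case_prod_beta)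
  then obtain P Q where P: "eventually P (nhds x)" and Q: "eventually Q (at_right 0)"
    and PQ: "\<And>y t. P y \<Longrightarrow> Q t \<Longrightarrow> (f (y + t *\<^sub>R d) - f y) / t < c"
    unfolding eventually_prod_filter fst_conv snd_conv by blast
  have "P x" using P by (rule eventually_nhds_x_imp_x)
  show ?thesis
    using Q eventually_at_right_less[of 0]
  proof eventually_elim
    case (elim t)
    with PQ[OF \<open>P x\<close>, of t] show ?case by (simp add: field_simps)
  qed
qed

theorem proposition3:
  fixes f :: "real ^ 'n \<Rightarrow> real"
    and x v d :: "real ^ 'n"
    and \<rho> \<xi> \<theta> :: real
  assumes "locally_lipschitz f"
    and "v \<noteq> 0" and "d \<noteq> 0"
    and "0 < \<rho>" and "\<rho> < 1"
    and "v \<bullet> d \<le> - \<rho> * norm v * norm d" and "- \<rho> * norm v * norm d < 0"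
    and "\<xi> \<ge> 0" and "0 < \<theta>" and "\<theta> < 1"
    and "\<bar>clarke_dd f x d - ereal (v \<bullet> d)\<bar> \<le> ereal (\<xi> * norm d)"
    and "\<xi> \<le> \<theta> * \<rho> * norm v"
  shows "\<forall>\<mu>. 0 < \<mu> \<and> \<mu> < 1 - \<theta> \<longrightarrow>
    (\<exists>t>0. f (x + t *\<^sub>R d) \<le> f x + \<mu> * t * (v \<bullet> d))"
proof (intro allI impI)
  fix \<mu> :: real
  assume \<mu>: "0 < \<mu> \<and> \<mu> < 1 - \<theta>"
  have neg: "v \<bullet> d < 0" using assms(6,7) by linarith
  have "\<xi> * norm d \<le> \<theta> * \<rho> * norm v * norm d"
    using assms(12) by (simp add: mult_right_mono)
  also have "\<dots> \<le> - \<theta> * (v \<bullet> d)"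
    using mult_left_mono[OF assms(6), of \<theta>] assms(9) by (simp add: algebra_simps)
  finally have err: "\<xi> * norm d \<le> - \<theta> * (v \<bullet> d)" .
  obtain r where r: "clarke_dd f x d = ereal r"
    using assms(11) by (cases "clarke_dd f x d") auto
  have "r \<le> v \<bullet> d + \<xi> * norm d" using assms(11) r by simp
  also have "\<dots> \<le> (1 - \<theta>) * (v \<bullet> d)" using err by (simp add: algebra_simps)
  also have "\<dots> < \<mu> * (v \<bullet> d)" using \<mu> neg by (simp add: mult_strict_right_mono_neg)
  finally have "\<forall>\<^sub>F t in at_right 0. f (x + t *\<^sub>R d) < f x + t * (\<mu> * (v \<bullet> d))"
    using r by (intro clarke_dd_less_imp_eventually_decrease) simp
  then have "\<forall>\<^sub>F t in at_right 0. t > 0 \<and> f (x + t *\<^sub>R d) < f x + t * (\<mu> * (v \<bullet> d))"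
    by (rule eventually_conj[OF eventually_at_right_less])
  then obtain t where "t > 0" "f (x + t *\<^sub>R d) < f x + t * (\<mu> * (v \<bullet> d))"
    using eventually_happens'[OF trivial_limit_at_right_real] by blast
  then show "\<exists>t>0. f (x + t *\<^sub>R d) \<le> f x + \<mu> * t * (v \<bullet> d)"
    by (intro exI[of _ t]) (simp add: mult_ac)
qed

end
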